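(* Let $H=(V,E,w)$ be a connected weighted hypergraph and let $s\in\mathbb R^V$ with $\mathbf 1^\top s=0$. Let $\mathcal M(s)$ be the set of feasible edge-mass vectors, and let $G^\uparrow=(V^\uparrow,A^\uparrow)$ be the lifted graph with demand vector $b^\uparrow$. Then $$\mathcal D^\star=\min_{\mu\in\mathcal M(s)}q(\mu).$$ For every $r\in\mathbb R^E_{\ge0}$, define arc costs $c^r_a:=r_e$ if $a=(e^-,e^+)$ for some $e\in E$, and $c^r_a:=0$ otherwise. Then $$L_s(r)=\min_{\mu\in\mathcal M(s)}\sum_{e\in E}r_e\mu_e=\min\Bigl\{\sum_{a\in A^\uparrow}c^r_af_a:\ A^\uparrow f=b^\uparrow,\ f\ge0\Bigr\}.$$ Moreover, if $\pi\in\mathbb R^{V^\uparrow}$ is any optimal dual potential for this min-cost-flow LP, meaning $$\bigl((A^\uparrow)^\top\pi\bigr)_a\le c^r_a\quad(a\in A^\uparrow),\qquad \langle b^\uparrow,\pi\rangle=L_s(r),$$ then the vector $$x_v:=\pi_v-\frac{\sum_{u\in V}d_u\pi_u}{\sum_{u\in V}d_u}\qquad(v\in V)$$ is an optimal solution of the maximization problem defining $L_s(r)$.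
   Context: A weighted hypergraph $H=(V,E,w)$ has a finite vertex set $V$, a finite nonempty family $E$ of nonempty subsets of $V$ (hyperedges), and weights $w_e>0$. It is connected if any two vertices $u,v$ are joined by a sequence $u=p_0,\dots,p_k=v$ of vertices and hyperedges $e_1,\dots,e_k$ with $p_{i-1},p_i\in e_i$. $R_e(x):=\max_{u\in e}x_u-\min_{v\in e}x_v$; $d_v:=\sum_{e\ni v}w_e$; $D:=\mathrm{diag}(d_v)$; $\mathcal X_0:=\{x\in\mathbb R^V:\langle Dx,\mathbf 1\rangle=0\}$. $U_e:=\{\eta\in\mathbb R^V:\operatorname{supp}(\eta)\subseteq e,\ \mathbf 1^\top\eta=0\}$, $\mathcal Y:=\prod_eU_e$, $B\eta:=\sum_e\eta_e$, $\mathcal D(\eta):=\sum_e\frac{\|\eta_e\|_1^2}{8w_e}$, $\mathcal D^\star:=\min\{\mathcal D(\eta):\eta\in\mathcal Y,\ B\eta=s\}$. $q(z):=\frac12\sum_ez_e^2/w_e$. $\mathcal M(s)$ is the set of $\mu\in\mathbb R^E_{\ge0}$ for which there are $p_{ev},n_{ev}\ge0$ ($e\in E$, $v\in e$) with $\sum_{e\ni v}(p_{ev}-n_{ev})=s_v$ for all $v\in V$ and $\sum_{v\in e}p_{ev}=\sum_{v\in e}n_{ev}=\mu_e$ for all $e\in E$. Support value: for $r\in\mathbb R^E_{\ge0}$, $L_s(r):=\max\{\langle s,x\rangle:\ x\in\mathcal X_0,\ R_e(x)\le r_e\ \forall e\in E\}$. Lifted graph: directed graph with nodes $V^\uparrow=V\cup\{e^+,e^-:e\in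 E\}$ and arc set $A^\uparrow$ consisting of $(e^+,v)$ and $(v,e^-)$ for $e\in E$, $v\in e$, and $(e^-,e^+)$ for $e\in E$. $A^\uparrow$ also denotes the incidence matrix $(A^\uparrow f)_u=\sum_{a\text{ into }u}f_a-\sum_{a\text{ out of }u}f_a$, so $((A^\uparrow)^\top\pi)_{(p,q)}=\pi_q-\pi_p$. $b^\uparrow_v=s_v$ for $v\in V$, $b^\uparrow_{e^+}=b^\uparrow_{e^-}=0$ for $e\in E$. *)

theory Defs
  imports "HOL-Analysis.Analysis"
begin

text \<open>
  A weighted hypergraph is given by a finite vertex type \<open>'v\<close> (so \<open>V = UNIV\<close>), a finite index
  type \<open>'e\<close> for the family of hyperedges, the vertex set \<open>ed e\<close> of each hyperedge, and the weight
  vector \<open>w\<close>. Thus the spaces of vectors over \<open>V\<close> and \<open>E\<close> are \<open>real ^ 'v\<close> and \<open>real ^ 'e\<close>.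
  Both are nonempty since types are. A set of hyperedges is the case in which \<open>ed\<close> is injective.
\<close>

definition weighted_hypergraph :: "('e::finite \<Rightarrow> 'v::finite set) \<Rightarrow> real ^ 'e \<Rightarrow> bool" where
  "weighted_hypergraph ed w \<longleftrightarrow> (\<forall>e. ed e \<noteq> {}) \<and> (\<forall>e. 0 < w $ e)"

definition hyper_connected :: "('e::finite \<Rightarrow> 'v::finite set) \<Rightarrow> bool" where
  "hyper_connected ed \<longleftrightarrow>
    (\<forall>u v. \<exists>(k::nat) (p :: nat \<Rightarrow> 'v) (es :: nat \<Rightarrow> 'e).
       p 0 = u \<and> p k = v \<and> (\<forall>i\<in>{1..k}. p (i - 1) \<in> ed (es i) \<and> p i \<in> ed (es i)))"

definition edge_range :: "('e::finite \<Rightarrow> 'v::finite set) \<Rightarrow> 'e \<Rightarrow> real ^ 'v \<Rightarrow> real" where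
  "edge_range ed e x = Max ((\<lambda>u. x $ u) ` ed e) - Min ((\<lambda>v. x $ v) ` ed e)"

definition deg :: "('e::finite \<Rightarrow> 'v::finite set) \<Rightarrow> real ^ 'e \<Rightarrow> 'v \<Rightarrow> real" where
  "deg ed w v = (\<Sum>e | v \<in> ed e. w $ e)"

definition deg_matrix :: "('e::finite \<Rightarrow> 'v::finite set) \<Rightarrow> real ^ 'e \<Rightarrow> real ^ 'v ^ 'v" where
  "deg_matrix ed w = (\<chi> u v. if u = v then deg ed w u else 0)"

definition X0 :: "('e::finite \<Rightarrow> 'v::finite set) \<Rightarrow> real ^ 'e \<Rightarrow> (real ^ 'v) set" where
  "X0 ed w = {x. (deg_matrix ed w *v x) \<bullet> 1 = 0}"

definition is_min :: "real \<Rightarrow> real set \<Rightarrow> bool" where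
  "is_min m S \<longleftrightarrow> m \<in> S \<and> (\<forall>y\<in>S. m \<le> y)"

definition is_max :: "real \<Rightarrow> real set \<Rightarrow> bool" where
  "is_max m S \<longleftrightarrow> m \<in> S \<and> (\<forall>y\<in>S. y \<le> m)"

definition edge_flows :: "('e::finite \<Rightarrow> 'v::finite set) \<Rightarrow> 'e \<Rightarrow> (real ^ 'v) set" where
  "edge_flows ed e = {\<eta>. {v. \<eta> $ v \<noteq> 0} \<subseteq> ed e \<and> 1 \<bullet> \<eta> = 0}"

definition flows :: "('e::finite \<Rightarrow> 'v::finite set) \<Rightarrow> (real ^ 'v ^ 'e) set" where
  "flows ed = {\<eta>. \<forall>e. \<eta> $ e \<in> edge_flows ed e}"

definition total_flow :: "real ^ 'v::finite ^ 'e::finite \<Rightarrow> real ^ 'v" where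
  "total_flow \<eta> = (\<Sum>e\<in>UNIV. \<eta> $ e)"

definition l1_norm :: "real ^ 'v::finite \<Rightarrow> real" where
  "l1_norm x = (\<Sum>v\<in>UNIV. \<bar>x $ v\<bar>)"

definition flow_energy :: "real ^ 'e::finite \<Rightarrow> real ^ 'v::finite ^ 'e \<Rightarrow> real" where
  "flow_energy w \<eta> = (\<Sum>e\<in>UNIV. (l1_norm (\<eta> $ e))\<^sup>2 / (8 * w $ e))"

definition flow_energies ::
    "('e::finite \<Rightarrow> 'v::finite set) \<Rightarrow> real ^ 'e \<Rightarrow> real ^ 'v \<Rightarrow> real set" where
  "flow_energies ed w s = flow_energy w ` {\<eta> \<in> flows ed. total_flow \<eta> = s}"

text \<open>\<open>Least\<close> and \<open>Greatest\<close> on the reals are meaningful only for attained extrema.\<close>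

definition D_star :: "('e::finite \<Rightarrow> 'v::finite set) \<Rightarrow> real ^ 'e \<Rightarrow> real ^ 'v \<Rightarrow> real" where
  "D_star ed w s = (LEAST m. m \<in> flow_energies ed w s)"

definition quad :: "real ^ 'e::finite \<Rightarrow> real ^ 'e \<Rightarrow> real" where
  "quad w z = 1 / 2 * (\<Sum>e\<in>UNIV. (z $ e)\<^sup>2 / w $ e)"

definition edge_masses :: "('e::finite \<Rightarrow> 'v::finite set) \<Rightarrow> real ^ 'v \<Rightarrow> (real ^ 'e) set" where
  "edge_masses ed s = {\<mu>. (\<forall>e. 0 \<le> \<mu> $ e) \<and>
     (\<exists>p n :: 'e \<Rightarrow> 'v \<Rightarrow> real.
        (\<forall>e. \<forall>v\<in>ed e. 0 \<le> p e v \<and> 0 \<le> n e v) \<and>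
        (\<forall>v. (\<Sum>e | v \<in> ed e. p e v - n e v) = s $ v) \<and>
        (\<forall>e. (\<Sum>v\<in>ed e. p e v) = \<mu> $ e \<and> (\<Sum>v\<in>ed e. n e v) = \<mu> $ e))}"

definition support_feasible ::
    "('e::finite \<Rightarrow> 'v::finite set) \<Rightarrow> real ^ 'e \<Rightarrow> real ^ 'e \<Rightarrow> (real ^ 'v) set" where
  "support_feasible ed w r = {x \<in> X0 ed w. \<forall>e. edge_range ed e x \<le> r $ e}"

definition support_value ::
    "('e::finite \<Rightarrow> 'v::finite set) \<Rightarrow> real ^ 'e \<Rightarrow> real ^ 'v \<Rightarrow> real ^ 'e \<Rightarrow> real" where
  "support_value ed w s r = (GREATEST m. m \<in> (\<lambda>x. s \<bullet> x) ` support_feasible ed w r)"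

text \<open>In the lifted graph, \<open>Plus e\<close> and \<open>Minus e\<close> are the nodes $e^+$ and $e^-$ of hyperedge \<open>e\<close>.\<close>

datatype ('v, 'e) lnode = Vert 'v | Plus 'e | Minus 'e

instance lnode :: (finite, finite) finite
proof
  have "(UNIV :: ('a, 'b) lnode set) \<subseteq> range Vert \<union> range Plus \<union> range Minus"
  proof
    show "u \<in> range Vert \<union> range Plus \<union> range Minus" for u :: "('a, 'b) lnode"
      by (cases u) simp_all
  qed
  then show "finite (UNIV :: ('a, 'b) lnode set)"
    by (rule finite_subset) simp
qed

type_synonym ('v, 'e) larc = "('v, 'e) lnode \<times> ('v, 'e) lnode"

definition lift_arcs :: "('e::finite \<Rightarrow> 'v::finite set) \<Rightarrow> ('v, 'e) larc set" where
  "lift_arcs ed =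
     {(Plus e, Vert v) | e v. v \<in> ed e} \<union> {(Vert v, Minus e) | e v. v \<in> ed e} \<union>
     {(Minus e, Plus e) | e. True}"

text \<open>
  Arc vectors are functions on pairs of nodes of which only the values on \<open>lift_arcs ed\<close> matter.
\<close>

definition lift_incidence ::
    "('e::finite \<Rightarrow> 'v::finite set) \<Rightarrow> (('v, 'e) larc \<Rightarrow> real) \<Rightarrow> real ^ ('v, 'e) lnode" where
  "lift_incidence ed f =
     (\<chi> u. (\<Sum>a | a \<in> lift_arcs ed \<and> snd a = u. f a) - (\<Sum>a | a \<in> lift_arcs ed \<and> fst a = u. f a))"

definition lift_coboundary :: "real ^ ('v::finite, 'e::finite) lnode \<Rightarrow> ('v, 'e) larc \<Rightarrow> real" where
  "lift_coboundary \<pi> a = \<pi> $ snd a - \<pi> $ fst a"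

lemma lift_coboundary_adjoint:
  fixes ed :: "'e::finite \<Rightarrow> 'v::finite set"
  shows "lift_incidence ed f \<bullet> \<pi> = (\<Sum>a\<in>lift_arcs ed. f a * lift_coboundary \<pi> a)"
proof -
  have *: "(\<Sum>u\<in>UNIV. (\<Sum>a | a \<in> lift_arcs ed \<and> h a = u. f a) * \<pi> $ u)
      = (\<Sum>a\<in>lift_arcs ed. f a * \<pi> $ h a)" for h :: "('v, 'e) larc \<Rightarrow> ('v, 'e) lnode"
  proof -
    have "(\<Sum>u\<in>UNIV. (\<Sum>a | a \<in> lift_arcs ed \<and> h a = u. f a) * \<pi> $ u)
        = (\<Sum>u\<in>UNIV. \<Sum>a | a \<in> lift_arcs ed \<and> h a = u. f a * \<pi> $ h a)"
      by (simp add: sum_distrib_right)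
    also have "\<dots> = (\<Sum>a\<in>lift_arcs ed. f a * \<pi> $ h a)"
      using sum.group[of "lift_arcs ed" UNIV h "\<lambda>a. f a * \<pi> $ h a"] by simp
    finally show ?thesis .
  qed
  show ?thesis
    by (simp add: inner_vec_def lift_incidence_def lift_coboundary_def left_diff_distrib
        right_diff_distrib sum_subtractf *)
qed

definition lift_demand :: "real ^ 'v::finite \<Rightarrow> real ^ ('v, 'e::finite) lnode" where
  "lift_demand s = (\<chi> u. case u of Vert v \<Rightarrow> s $ v | Plus e \<Rightarrow> 0 | Minus e \<Rightarrow> 0)"

definition lift_cost :: "real ^ 'e::finite \<Rightarrow> ('v::finite, 'e) larc \<Rightarrow> real" where
  "lift_cost r a = (case a of (Minus e, Plus e') \<Rightarrow> if e = e' then r $ e else 0 | _ \<Rightarrow> 0)"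

definition lift_flows ::
    "('e::finite \<Rightarrow> 'v::finite set) \<Rightarrow> real ^ 'v \<Rightarrow> (('v, 'e) larc \<Rightarrow> real) set" where
  "lift_flows ed s =
     {f. lift_incidence ed f = lift_demand s \<and> (\<forall>a\<in>lift_arcs ed. 0 \<le> f a)}"

definition optimal_potential ::
    "('e::finite \<Rightarrow> 'v::finite set) \<Rightarrow> real ^ 'e \<Rightarrow> real ^ 'v \<Rightarrow> real ^ 'e \<Rightarrow>
     real ^ ('v, 'e) lnode \<Rightarrow> bool" where
  "optimal_potential ed w s r \<pi> \<longleftrightarrow>
     (\<forall>a\<in>lift_arcs ed. lift_coboundary \<pi> a \<le> lift_cost r a) \<and>
     lift_demand s \<bullet> \<pi> = support_value ed w s r"

end

theory Submission
  imports Defs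
begin

text \<open>
  Splitting an edge flow into its positive and negative parts gives masses
  $\mu_e = \|\eta_e\|_1 / 2$, and $\|\eta_e\|_1^2 / 8 w_e = \mu_e^2 / 2 w_e$; conversely
  $\eta = p - n$ satisfies $\|\eta_e\|_1 \le 2 \mu_e$. An edge-mass vector is a flow in the
  lifted graph read off on the arcs $(e^-, e^+)$. The duality between $L_s(r)$ and the masses is
  Farkas' lemma for the cone generated by the transports $(1_u - 1_v, r_e)$ with $u, v \in e$
  and by the slack $(0, 1)$: a functional $(-x, \tau)$ separating $(s, L_s(r))$ from this cone
  would, after division by $\tau$ and recentring into $\mathcal X_0$, be a feasible point of value
  larger than $L_s(r)$. The case $\tau = 0$ is impossible, since then $x$ is constant on the
  connected hypergraph while $\langle s, 1 \rangle = 0$.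
\<close>

section \<open>Potentials\<close>

text \<open>Turns a range bound into finitely many linear inequalities, the form used for
  closedness, for translation invariance and for the dual cone.\<close>

lemma edge_range_le_iff:
  fixes ed :: "'e::finite \<Rightarrow> 'v::finite set"
  assumes "ed e \<noteq> {}"
  shows "edge_range ed e x \<le> c \<longleftrightarrow> (\<forall>u\<in>ed e. \<forall>v\<in>ed e. x $ u - x $ v \<le> c)"
proof
  let ?X = "(\<lambda>u. x $ u) ` ed e"
  show "\<forall>u\<in>ed e. \<forall>v\<in>ed e. x $ u - x $ v \<le> c" if "edge_range ed e x \<le> c"
  proof (intro ballI)
    fix u v assume "u \<in> ed e" "v \<in> ed e"
    then have "x $ u \<le> Max ?X" "Min ?X \<le> x $ v" by auto
    with that show "x $ u - x $ v \<le> c" by (simp add: edge_range_def)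
  qed
  assume *: "\<forall>u\<in>ed e. \<forall>v\<in>ed e. x $ u - x $ v \<le> c"
  have "Max ?X \<in> ?X" "Min ?X \<in> ?X" using assms by (auto intro!: Max_in Min_in)
  then show "edge_range ed e x \<le> c" using * by (auto simp: edge_range_def)
qed

text \<open>Telescoping along a path from \<open>u\<close> to \<open>v\<close>. The length
  \<open>k\<close> is chosen before \<open>x\<close> and \<open>c\<close>, so it gives a uniform
  bound on differences, and with \<open>c = 0\<close> it gives constancy.\<close>

lemma hyper_connected_diff_bound:
  fixes ed :: "'e::finite \<Rightarrow> 'v::finite set"
  assumes "hyper_connected ed"
  shows "\<exists>k::nat. \<forall>(x :: real ^ 'v) c. (\<forall>e. \<forall>u\<in>ed e. \<forall>v\<in>ed e. x $ u - x $ v \<le> c) \<longrightarrow>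
      x $ u - x $ v \<le> real k * c"
proof -
  obtain k p es where p: "p 0 = u" "p k = v"
      "\<forall>i\<in>{1..k::nat}. p (i - 1) \<in> ed (es i) \<and> p i \<in> ed (es i)"
    using assms unfolding hyper_connected_def by metis
  have "x $ p 0 - x $ p j \<le> real j * c"
    if *: "\<forall>e. \<forall>u\<in>ed e. \<forall>v\<in>ed e. x $ u - x $ v \<le> c" and "j \<le> k" for x :: "real ^ 'v" and c j
    using that(2)
  proof (induction j)
    case (Suc j)
    have "p j \<in> ed (es (Suc j))" "p (Suc j) \<in> ed (es (Suc j))" using p(3) Suc.prems by force+
    then have "x $ p j - x $ p (Suc j) \<le> c" using * by blast
    then show ?case using Suc by (simp add: algebra_simps)
  qed simp
  then show ?thesis using p by blast
qed

lemma mem_X0_iff: "x \<in> X0 ed w \<longleftrightarrow> (\<Sum>v\<in>UNIV. deg ed w v * x $ v) = 0"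
proof -
  have "(deg_matrix ed w *v x) $ v = deg ed w v * x $ v" for v
    by (simp add: deg_matrix_def matrix_vector_mult_def if_distrib[of "\<lambda>y. y * _"] cong: if_cong)
  then show ?thesis by (simp add: X0_def inner_vec_def)
qed

lemma deg_nonneg: "weighted_hypergraph ed w \<Longrightarrow> 0 \<le> deg ed w v"
  unfolding weighted_hypergraph_def deg_def by (meson less_imp_le sum_nonneg)

text \<open>Any vertex of any hyperedge has positive degree; this keeps the denominator of the
  weighted mean nonzero.\<close>

lemma sum_deg_pos:
  fixes ed :: "'e::finite \<Rightarrow> 'v::finite set"
  assumes "weighted_hypergraph ed w"
  shows "0 < (\<Sum>v\<in>UNIV. deg ed w v)"
proof -
  obtain e :: 'e and v where "v \<in> ed e"
    using assms unfolding weighted_hypergraph_def by blast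
  then have "w $ e \<le> deg ed w v"
    unfolding deg_def using assms
    by (intro member_le_sum) (auto simp: weighted_hypergraph_def less_imp_le)
  moreover have "0 < w $ e" using assms by (simp add: weighted_hypergraph_def)
  ultimately have "0 < deg ed w v" by simp
  then show ?thesis using deg_nonneg[OF assms] by (intro sum_pos2[where i = v]) auto
qed

text \<open>Subtracting the degree-weighted mean is the translation along the all-ones vector that
  lands in \<open>X0 ed w\<close>.\<close>

definition recenter :: "('e::finite \<Rightarrow> 'v::finite set) \<Rightarrow> real ^ 'e \<Rightarrow> real ^ 'v \<Rightarrow> real ^ 'v" where
  "recenter ed w x =
     (\<chi> v. x $ v - (\<Sum>u\<in>UNIV. deg ed w u * x $ u) / (\<Sum>u\<in>UNIV. deg ed w u))"

lemma inner_recenter: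
  assumes "1 \<bullet> s = 0"
  shows "s \<bullet> recenter ed w x = s \<bullet> x"
proof -
  define c where "c = (\<Sum>u\<in>UNIV. deg ed w u * x $ u) / (\<Sum>u\<in>UNIV. deg ed w u)"
  have "s \<bullet> recenter ed w x = s \<bullet> x - (1 \<bullet> s) * c"
    by (simp add: recenter_def inner_vec_def right_diff_distrib sum_subtractf sum_distrib_right
        flip: c_def)
  with assms show ?thesis by simp
qed

text \<open>Differences on hyperedges are invariant under translation, so the only new condition is
  the weighted mean zero.\<close>

lemma recenter_support_feasible:
  fixes ed :: "'e::finite \<Rightarrow> 'v::finite set"
  assumes "weighted_hypergraph ed w"
    and "\<And>e u v. u \<in> ed e \<Longrightarrow> v \<in> ed e \<Longrightarrow> x $ u - x $ v \<le> r $ e"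
  shows "recenter ed w x \<in> support_feasible ed w r"
proof -
  have "(\<Sum>v\<in>UNIV. deg ed w v * recenter ed w x $ v) = 0"
    using sum_deg_pos[OF assms(1)]
    by (simp add: recenter_def right_diff_distrib sum_subtractf flip: sum_distrib_right sum_divide_distrib)
  moreover have "edge_range ed e (recenter ed w x) \<le> r $ e" for e
    using assms by (subst edge_range_le_iff) (auto simp: weighted_hypergraph_def recenter_def)
  ultimately show ?thesis by (simp add: support_feasible_def mem_X0_iff)
qed

section \<open>Compactness of the feasible potentials and attainment of the support value\<close>

lemma support_feasible_iff:
  fixes ed :: "'e::finite \<Rightarrow> 'v::finite set"
  assumes "weighted_hypergraph ed w"
  shows "support_feasible ed w r =
    {x. (\<Sum>v\<in>UNIV. deg ed w v * x $ v) = 0 \<and> (\<forall>e. \<forall>u\<in>ed e. \<forall>v\<in>ed e. x $ u - x $ v \<le> r $ e)}"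
  using assms by (auto simp: support_feasible_def mem_X0_iff weighted_hypergraph_def edge_range_le_iff)

text \<open>Connectivity bounds all differences of coordinates, and the weighted mean zero then
  fixes the level, so the coordinates themselves are bounded.\<close>

lemma compact_support_feasible:
  fixes ed :: "'e::finite \<Rightarrow> 'v::finite set"
  assumes "weighted_hypergraph ed w" "hyper_connected ed" "\<forall>e. 0 \<le> r $ e"
  shows "compact (support_feasible ed w r)"
proof -
  let ?F = "support_feasible ed w r"
  have "closed ?F"
    \<comment> \<open>\<open>Ball_def\<close> exposes implications whose premise does not depend on
      \<open>x\<close>; \<open>open_Collect_const\<close> then supplies the open premise that
      \<open>closed_Collect_imp\<close> asks for.\<close>
    unfolding support_feasible_iff[OF assms(1)] Ball_def
    by (intro closed_Collect_conj closed_Collect_all closed_Collect_imp closed_Collect_eq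
        closed_Collect_le continuous_intros open_Collect_const)
  define D where "D = (\<Sum>v\<in>UNIV. deg ed w v)"
  have D: "0 < D" using sum_deg_pos[OF assms(1)] by (simp add: D_def)
  define c where "c = (\<Sum>e\<in>UNIV. r $ e)"
  have c: "r $ e \<le> c" for e unfolding c_def using assms(3) by (intro member_le_sum) auto
  have "0 \<le> c" unfolding c_def using assms(3) by (simp add: sum_nonneg)
  obtain k where k: "\<And>u v (x :: real ^ 'v) c.
      (\<forall>e. \<forall>u\<in>ed e. \<forall>v\<in>ed e. x $ u - x $ v \<le> c) \<Longrightarrow> x $ u - x $ v \<le> real (k u v) * c"
    using hyper_connected_diff_bound[OF assms(2)] by metis
  \<comment> \<open>Sums stand in for maxima: \<open>c\<close> dominates every \<open>r $ e\<close>,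
    and the sum of all path lengths dominates each \<open>k u v\<close>.\<close>
  define K where "K = real (\<Sum>(u, v)\<in>UNIV. k u v) * c"
  have diff: "x $ u - x $ v \<le> K" if "x \<in> ?F" for x u v
  proof -
    have "x $ u - x $ v \<le> real (k u v) * c"
      using that order_trans[OF _ c] unfolding support_feasible_iff[OF assms(1)]
      by (intro k) blast
    also have "k u v \<le> (\<Sum>(u, v)\<in>UNIV. k u v)"
      using member_le_sum[of "(u, v)" UNIV "\<lambda>(u, v). k u v"] by simp
    then have "real (k u v) * c \<le> K"
      unfolding K_def using \<open>0 \<le> c\<close> by (intro mult_right_mono of_nat_mono)
    finally show ?thesis .
  qed
  have "\<bar>x $ v\<bar> \<le> K" if x: "x \<in> ?F" for x v
  proof -
    have 0: "(\<Sum>u\<in>UNIV. deg ed w u * x $ u) = 0"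
      using x by (simp add: support_feasible_iff[OF assms(1)])
    \<comment> \<open>As the weighted mean vanishes, \<open>D * x $ v\<close> is a weighted sum of
      differences, each at most \<open>K\<close>; the mirrored estimate treats
      \<open>- x $ v\<close>.\<close>
    have "D * x $ v = (\<Sum>u\<in>UNIV. deg ed w u * (x $ v - x $ u))"
      using 0 by (simp add: D_def right_diff_distrib sum_subtractf sum_distrib_right)
    also have "\<dots> \<le> (\<Sum>u\<in>UNIV. deg ed w u * K)"
      using diff[OF x] deg_nonneg[OF assms(1)] by (intro sum_mono mult_left_mono) auto
    finally have 1: "D * x $ v \<le> D * K" by (simp add: D_def sum_distrib_right)
    have "D * - x $ v = (\<Sum>u\<in>UNIV. deg ed w u * (x $ u - x $ v))"
      using 0 by (simp add: D_def right_diff_distrib sum_subtractf sum_distrib_right)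
    also have "\<dots> \<le> (\<Sum>u\<in>UNIV. deg ed w u * K)"
      using diff[OF x] deg_nonneg[OF assms(1)] by (intro sum_mono mult_left_mono) auto
    finally have 2: "D * - x $ v \<le> D * K" by (simp add: D_def sum_distrib_right)
    show ?thesis
      using mult_left_le_imp_le[OF 1 D] mult_left_le_imp_le[OF 2 D] by linarith
  qed
  then have "norm x \<le> (\<Sum>v\<in>(UNIV :: 'v set). K)" if "x \<in> ?F" for x
    using that by (intro order_trans[OF norm_le_l1_cart] sum_mono)
  then have "bounded ?F" by (rule boundedI)
  with \<open>closed ?F\<close> show ?thesis by (simp add: compact_eq_bounded_closed)
qed

text \<open>The zero vector is feasible since \<open>r\<close> is nonnegative, so the linear
  objective attains its maximum on a nonempty compact set. This justifies the use of
  \<open>GREATEST\<close> in \<open>support_value\<close>.\<close>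

lemma support_value_is_max:
  fixes ed :: "'e::finite \<Rightarrow> 'v::finite set"
  assumes "weighted_hypergraph ed w" "hyper_connected ed" "\<forall>e. 0 \<le> r $ e"
  shows "is_max (support_value ed w s r) ((\<lambda>x. s \<bullet> x) ` support_feasible ed w r)"
proof -
  let ?F = "support_feasible ed w r"
  have "0 \<in> ?F" using assms(3) by (simp add: support_feasible_iff[OF assms(1)])
  then have "\<exists>x\<in>?F. \<forall>y\<in>?F. s \<bullet> y \<le> s \<bullet> x"
    by (intro continuous_attains_sup compact_support_feasible[OF assms] continuous_intros) auto
  then obtain x where "x \<in> ?F" "\<forall>y\<in>?F. s \<bullet> y \<le> s \<bullet> x" ..
  then have max: "is_max (s \<bullet> x) ((\<lambda>x. s \<bullet> x) ` ?F)" by (auto simp: is_max_def)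
  then have "support_value ed w s r = s \<bullet> x"
    unfolding support_value_def is_max_def by (intro Greatest_equality) auto
  with max show ?thesis by simp
qed

section \<open>Edge masses\<close>

lemma edge_massesI:
  fixes ed :: "'e::finite \<Rightarrow> 'v::finite set"
  assumes "\<And>e v. v \<in> ed e \<Longrightarrow> 0 \<le> p e v" "\<And>e v. v \<in> ed e \<Longrightarrow> 0 \<le> n e v"
    and "\<And>v. (\<Sum>e | v \<in> ed e. p e v - n e v) = s $ v"
    and "\<And>e. (\<Sum>v\<in>ed e. p e v) = \<mu> $ e" "\<And>e. (\<Sum>v\<in>ed e. n e v) = \<mu> $ e"
  shows "\<mu> \<in> edge_masses ed s"
proof -
  have "0 \<le> \<mu> $ e" for e using assms(1,4) by (metis sum_nonneg)
  then show ?thesis unfolding edge_masses_def using assms by blast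
qed

lemma edge_massesE:
  fixes ed :: "'e::finite \<Rightarrow> 'v::finite set"
  assumes "\<mu> \<in> edge_masses ed s"
  obtains p n where "\<And>e v. v \<in> ed e \<Longrightarrow> 0 \<le> p e v" "\<And>e v. v \<in> ed e \<Longrightarrow> 0 \<le> n e v"
    "\<And>v. (\<Sum>e | v \<in> ed e. p e v - n e v) = s $ v"
    "\<And>e. (\<Sum>v\<in>ed e. p e v) = \<mu> $ e" "\<And>e. (\<Sum>v\<in>ed e. n e v) = \<mu> $ e"
  using assms unfolding edge_masses_def by blast

lemma edge_masses_nonneg: "\<mu> \<in> edge_masses ed s \<Longrightarrow> 0 \<le> \<mu> $ e"
  by (simp add: edge_masses_def)

text \<open>Together with \<open>edge_masses_add\<close> and \<open>edge_masses_scale\<close>: the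
  pairs of a demand and a feasible mass vector form a convex cone.\<close>

lemma edge_masses_zero: "0 \<in> edge_masses ed 0"
  by (rule edge_massesI[where p = "\<lambda>_ _. 0" and n = "\<lambda>_ _. 0"]) auto

lemma edge_masses_add:
  fixes ed :: "'e::finite \<Rightarrow> 'v::finite set"
  assumes "\<mu> \<in> edge_masses ed s" "\<nu> \<in> edge_masses ed t"
  shows "\<mu> + \<nu> \<in> edge_masses ed (s + t)"
  using assms(1)
proof (rule edge_massesE)
  fix p n
  assume 1: "\<And>e v. v \<in> ed e \<Longrightarrow> 0 \<le> p e v" "\<And>e v. v \<in> ed e \<Longrightarrow> 0 \<le> n e v"
    "\<And>v. (\<Sum>e | v \<in> ed e. p e v - n e v) = s $ v"
    "\<And>e. (\<Sum>v\<in>ed e. p e v) = \<mu> $ e" "\<And>e. (\<Sum>v\<in>ed e. n e v) = \<mu> $ e"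
  from assms(2) show ?thesis
  proof (rule edge_massesE)
    fix p' n'
    assume 2: "\<And>e v. v \<in> ed e \<Longrightarrow> 0 \<le> p' e v" "\<And>e v. v \<in> ed e \<Longrightarrow> 0 \<le> n' e v"
      "\<And>v. (\<Sum>e | v \<in> ed e. p' e v - n' e v) = t $ v"
      "\<And>e. (\<Sum>v\<in>ed e. p' e v) = \<nu> $ e" "\<And>e. (\<Sum>v\<in>ed e. n' e v) = \<nu> $ e"
    show ?thesis
      by (rule edge_massesI[where p = "\<lambda>e v. p e v + p' e v" and n = "\<lambda>e v. n e v + n' e v"])
        (simp_all add: 1 2 add_diff_add sum.distrib)
  qed
qed

lemma edge_masses_scale:
  fixes ed :: "'e::finite \<Rightarrow> 'v::finite set"
  assumes "\<mu> \<in> edge_masses ed s" "0 \<le> c"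
  shows "c *\<^sub>R \<mu> \<in> edge_masses ed (c *\<^sub>R s)"
  using assms(1)
proof (rule edge_massesE)
  fix p n
  assume 1: "\<And>e v. v \<in> ed e \<Longrightarrow> 0 \<le> p e v" "\<And>e v. v \<in> ed e \<Longrightarrow> 0 \<le> n e v"
    "\<And>v. (\<Sum>e | v \<in> ed e. p e v - n e v) = s $ v"
    "\<And>e. (\<Sum>v\<in>ed e. p e v) = \<mu> $ e" "\<And>e. (\<Sum>v\<in>ed e. n e v) = \<mu> $ e"
  show ?thesis
    by (rule edge_massesI[where p = "\<lambda>e v. c * p e v" and n = "\<lambda>e v. c * n e v"])
      (simp_all add: 1 assms(2) flip: right_diff_distrib sum_distrib_left)
qed

text \<open>Moving one unit from \<open>v\<close> to \<open>u\<close> inside \<open>e\<close> uses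
  mass one on \<open>e\<close> and none elsewhere: \<open>p\<close> is concentrated at
  \<open>u\<close>, \<open>n\<close> at \<open>v\<close>. For \<open>u = v\<close> the demand
  cancels but the mass remains one.\<close>

lemma edge_masses_transport:
  fixes ed :: "'e::finite \<Rightarrow> 'v::finite set"
  assumes "u \<in> ed e" "v \<in> ed e"
  shows "axis e 1 \<in> edge_masses ed (axis u 1 - axis v 1)"
proof (rule edge_massesI)
  let ?p = "\<lambda>u e' v'. if e' = e \<and> v' = u then 1 else 0 :: real"
  show "(\<Sum>e' | v' \<in> ed e'. ?p u e' v' - ?p v e' v') = (axis u 1 - axis v 1 :: real ^ 'v) $ v'" for v'
    using assms by (auto simp: sum_subtractf axis_def)
  have *: "(\<Sum>v'\<in>ed e'. ?p a e' v') = axis e 1 $ e'" if "a \<in> ed e" for a e'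
    using that by (auto simp: axis_def)
  show "(\<Sum>v'\<in>ed e'. ?p u e' v') = axis e 1 $ e'" "(\<Sum>v'\<in>ed e'. ?p v e' v') = axis e 1 $ e'" for e'
    using * assms by blast+
qed auto

text \<open>After regrouping by hyperedges, the contribution of \<open>e\<close> is largest when its
  mass enters at the maximum of \<open>x\<close> on \<open>e\<close> and leaves at the minimum,
  which gives at most the range times the mass.\<close>

lemma edge_masses_weak_duality:
  fixes ed :: "'e::finite \<Rightarrow> 'v::finite set"
  assumes "\<mu> \<in> edge_masses ed s" "\<And>e. edge_range ed e x \<le> r $ e"
  shows "s \<bullet> x \<le> (\<Sum>e\<in>UNIV. r $ e * \<mu> $ e)"
  using assms(1)
proof (rule edge_massesE)
  fix p n
  assume pn: "\<And>e v. v \<in> ed e \<Longrightarrow> 0 \<le> p e v" "\<And>e v. v \<in> ed e \<Longrightarrow> 0 \<le> n e v"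
    and s: "\<And>v. (\<Sum>e | v \<in> ed e. p e v - n e v) = s $ v"
    and \<mu>: "\<And>e. (\<Sum>v\<in>ed e. p e v) = \<mu> $ e" "\<And>e. (\<Sum>v\<in>ed e. n e v) = \<mu> $ e"
  have "s \<bullet> x = (\<Sum>v\<in>UNIV. \<Sum>e | v \<in> ed e. (p e v - n e v) * x $ v)"
    by (simp add: inner_vec_def flip: s sum_distrib_right)
  also have "\<dots> = (\<Sum>e\<in>UNIV. \<Sum>v\<in>ed e. (p e v - n e v) * x $ v)"
    using sum.swap_restrict[of UNIV UNIV "\<lambda>v e. (p e v - n e v) * x $ v" "\<lambda>v e. v \<in> ed e"] by simp
  also have "\<dots> \<le> (\<Sum>e\<in>UNIV. r $ e * \<mu> $ e)"
  proof (rule sum_mono)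
    fix e
    let ?X = "(\<lambda>u. x $ u) ` ed e"
    have "(\<Sum>v\<in>ed e. (p e v - n e v) * x $ v)
        = (\<Sum>v\<in>ed e. p e v * x $ v) - (\<Sum>v\<in>ed e. n e v * x $ v)"
      by (simp add: left_diff_distrib sum_subtractf)
    also have "\<dots> \<le> (\<Sum>v\<in>ed e. p e v * Max ?X) - (\<Sum>v\<in>ed e. n e v * Min ?X)"
      using pn by (intro diff_mono sum_mono mult_left_mono) auto
    also have "\<dots> = edge_range ed e x * \<mu> $ e"
      by (simp add: \<mu> edge_range_def algebra_simps flip: sum_distrib_right)
    also have "\<dots> \<le> r $ e * \<mu> $ e"
      using assms edge_masses_nonneg by (intro mult_right_mono) auto
    finally show "(\<Sum>v\<in>ed e. (p e v - n e v) * x $ v) \<le> r $ e * \<mu> $ e" .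
  qed
  finally show ?thesis .
qed

text \<open>A finitely generated cone is closed, so a point outside it is strictly separated from it
  by a hyperplane; on a cone the separating functional must be nonnegative.\<close>

lemma convex_cone_hull_farkas:
  fixes G :: "'a::euclidean_space set"
  assumes "finite G" "\<And>y. (\<And>g. g \<in> G \<Longrightarrow> 0 \<le> y \<bullet> g) \<Longrightarrow> 0 \<le> y \<bullet> z"
  shows "z \<in> convex_cone hull G"
proof (rule ccontr)
  let ?C = "convex_cone hull G"
  assume "z \<notin> ?C"
  then obtain y b where y: "y \<bullet> z < b" "\<And>x. x \<in> ?C \<Longrightarrow> b < y \<bullet> x"
    using separating_hyperplane_closed_point[of ?C z] closed_convex_cone_hull[OF assms(1)]
      convex_convex_cone_hull[of G] by blast
  have "b < 0" using y(2)[OF convex_cone_hull_contains_0] by simp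
  have "0 \<le> y \<bullet> g" if "g \<in> G" for g
  proof (rule ccontr)
    assume neg: "\<not> 0 \<le> y \<bullet> g"
    \<comment> \<open>This multiple of \<open>g\<close> has value exactly \<open>b\<close>, against
      the strict separation.\<close>
    then have "(b / (y \<bullet> g)) *\<^sub>R g \<in> ?C"
      using that \<open>b < 0\<close> by (intro convex_cone_hull_mul hull_inc) (auto simp: divide_nonpos_nonpos)
    from y(2)[OF this] neg show False by simp
  qed
  then show False using assms(2) y(1) \<open>b < 0\<close> by force
qed

text \<open>Membership of \<open>(s, L)\<close> in a finitely generated cone yields the mass vector
  itself, so the minimum is attained without a separate compactness argument.\<close>

lemma edge_masses_strong_duality:
  fixes ed :: "'e::finite \<Rightarrow> 'v::finite set"
  assumes "weighted_hypergraph ed w" "hyper_connected ed" "1 \<bullet> s = 0"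
    and max: "\<And>x. x \<in> support_feasible ed w r \<Longrightarrow> s \<bullet> x \<le> L"
  obtains \<mu> where "\<mu> \<in> edge_masses ed s" "(\<Sum>e\<in>UNIV. r $ e * \<mu> $ e) \<le> L"
proof -
  define T :: "((real ^ 'v) \<times> real) set" where
    "T = (\<lambda>(e, u, v). (axis u 1 - axis v 1, r $ e)) ` {(e, u, v). u \<in> ed e \<and> v \<in> ed e}"
  \<comment> \<open>\<open>K\<close> collects the demands that can be met at cost at most
    \<open>t\<close>; the inequality makes room for the slack generator
    \<open>(0, 1)\<close>.\<close>
  define K where "K = {(s, t). \<exists>\<mu>\<in>edge_masses ed s. (\<Sum>e\<in>UNIV. r $ e * \<mu> $ e) \<le> t}"
  have "(s, L) \<in> convex_cone hull (insert (0, 1) T)"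
  proof (rule convex_cone_hull_farkas)
    fix y :: "(real ^ 'v) \<times> real"
    assume y: "\<And>g. g \<in> insert (0, 1) T \<Longrightarrow> 0 \<le> y \<bullet> g"
    \<comment> \<open>With this sign, nonnegativity of \<open>y\<close> on the transports reads as
      the range constraints scaled by \<open>\<tau>\<close>.\<close>
    define x \<tau> where "x = - fst y" and "\<tau> = snd y"
    have y_eq: "y = (- x, \<tau>)" by (simp add: x_def \<tau>_def)
    have "0 \<le> \<tau>" using y[of "(0, 1)"] by (simp add: y_eq)
    have diff: "x $ u - x $ v \<le> \<tau> * r $ e" if "u \<in> ed e" "v \<in> ed e" for e u v
    proof -
      have "(axis u 1 - axis v 1, r $ e) \<in> T" using that by (force simp: T_def)
      then have "0 \<le> y \<bullet> (axis u 1 - axis v 1, r $ e)" by (intro y) simp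
      then show ?thesis by (simp add: y_eq inner_diff_right inner_axis)
    qed
    have "s \<bullet> x \<le> \<tau> * L"
    proof (cases "\<tau> = 0")
      case True
      have le: "x $ u \<le> x $ v" for u v
      proof -
        obtain k :: nat where "(\<forall>e. \<forall>u\<in>ed e. \<forall>v\<in>ed e. x $ u - x $ v \<le> 0) \<longrightarrow>
            x $ u - x $ v \<le> real k * 0"
          using hyper_connected_diff_bound[OF assms(2)] by blast
        with diff True show ?thesis by simp
      qed
      \<comment> \<open>\<open>undefined\<close> is just some vertex; \<open>x\<close> takes the
        same value everywhere.\<close>
      define a where "a = x $ undefined"
      have "x $ v = a" for v unfolding a_def by (intro order_antisym le)
      then have "s \<bullet> x = (1 \<bullet> s) * a"
        by (simp add: inner_vec_def sum_distrib_right)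
      then show ?thesis using True assms(3) by simp
    next
      case False
      then have "0 < \<tau>" using \<open>0 \<le> \<tau>\<close> by simp
      then have "recenter ed w (x /\<^sub>R \<tau>) \<in> support_feasible ed w r"
        using diff by (intro recenter_support_feasible[OF assms(1)])
          (simp add: field_simps)
      from max[OF this] show ?thesis
        using \<open>0 < \<tau>\<close> by (simp add: inner_recenter[OF assms(3)] field_simps)
    qed
    then show "0 \<le> y \<bullet> (s, L)" by (simp add: y_eq inner_commute mult.commute)
  qed (simp add: T_def)
  \<comment> \<open>\<open>K\<close> is a convex cone containing the generators, so it contains
    their hull and hence \<open>(s, L)\<close>.\<close>
  also have "convex_cone hull (insert (0, 1) T) \<subseteq> K"
  proof (rule hull_minimal)
    show "insert (0, 1) T \<subseteq> K"
    proof -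
      have "(0, 1) \<in> K" unfolding K_def by (auto intro!: bexI[OF _ edge_masses_zero])
      moreover have "(axis u 1 - axis v 1, r $ e) \<in> K" if "u \<in> ed e" "v \<in> ed e" for e u v
        unfolding K_def using edge_masses_transport[where ed = ed, OF that]
        by (auto intro!: bexI[of _ "axis e 1"] simp: axis_def if_distrib cong: if_cong)
      ultimately show ?thesis unfolding T_def by auto
    qed
    show "convex_cone K"
      unfolding convex_cone_iff
    proof (intro conjI ballI allI impI)
      show "0 \<in> K" unfolding K_def zero_prod_def by (auto intro!: bexI[OF _ edge_masses_zero])
      fix a b assume "a \<in> K" "b \<in> K"
      then obtain \<mu> \<nu> where "\<mu> \<in> edge_masses ed (fst a)" "(\<Sum>e\<in>UNIV. r $ e * \<mu> $ e) \<le> snd a"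
        "\<nu> \<in> edge_masses ed (fst b)" "(\<Sum>e\<in>UNIV. r $ e * \<nu> $ e) \<le> snd b"
        unfolding K_def by auto
      then show "a + b \<in> K"
        unfolding K_def
        by (auto simp: case_prod_beta distrib_left sum.distrib intro!: bexI[OF _ edge_masses_add])
    next
      fix a and c :: real assume "a \<in> K" "0 \<le> c"
      then obtain \<mu> where "\<mu> \<in> edge_masses ed (fst a)" "(\<Sum>e\<in>UNIV. r $ e * \<mu> $ e) \<le> snd a"
        unfolding K_def by auto
      then show "c *\<^sub>R a \<in> K"
        unfolding K_def using \<open>0 \<le> c\<close>
        by (auto simp: case_prod_beta mult.left_commute[of _ c] mult_left_mono
            simp flip: sum_distrib_left intro!: bexI[OF _ edge_masses_scale])
    qed
  qed
  finally show thesis using that by (auto simp: K_def)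
qed

section \<open>Edge flows\<close>

lemma flows_iff:
  fixes ed :: "'e::finite \<Rightarrow> 'v::finite set"
  shows "\<eta> \<in> flows ed \<longleftrightarrow>
    (\<forall>e. (\<forall>v. v \<notin> ed e \<longrightarrow> \<eta> $ e $ v = 0) \<and> (\<Sum>v\<in>UNIV. \<eta> $ e $ v) = 0)"
  by (auto simp: flows_def edge_flows_def inner_vec_def)

lemma total_flow_nth: "total_flow \<eta> $ v = (\<Sum>e\<in>UNIV. \<eta> $ e $ v)"
  by (simp add: total_flow_def)

text \<open>The positive and negative parts of an edge flow serve as \<open>p\<close> and
  \<open>n\<close>. Their totals differ by zero and add up to the l1 norm, so each is half of
  it.\<close>

lemma edge_masses_of_flow:
  fixes ed :: "'e::finite \<Rightarrow> 'v::finite set"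
  assumes "\<eta> \<in> flows ed"
  shows "(\<chi> e. l1_norm (\<eta> $ e) / 2) \<in> edge_masses ed (total_flow \<eta>)"
proof -
  have 0: "\<eta> $ e $ v = 0" if "v \<notin> ed e" for e v using assms that by (simp add: flows_iff)
  have pos: "(\<Sum>v\<in>ed e. max (\<eta> $ e $ v) 0) = l1_norm (\<eta> $ e) / 2"
    and neg: "(\<Sum>v\<in>ed e. max (- \<eta> $ e $ v) 0) = l1_norm (\<eta> $ e) / 2" for e
  proof -
    have "(\<Sum>v\<in>ed e. max (\<eta> $ e $ v) 0) - (\<Sum>v\<in>ed e. max (- \<eta> $ e $ v) 0)
        = (\<Sum>v\<in>ed e. \<eta> $ e $ v)"
      by (simp flip: sum_subtractf) (auto intro: sum.cong)
    also have "\<dots> = (\<Sum>v\<in>UNIV. \<eta> $ e $ v)" using 0 by (intro sum.mono_neutral_left) auto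
    also have "\<dots> = 0" using assms by (simp add: flows_iff)
    finally have diff:
      "(\<Sum>v\<in>ed e. max (\<eta> $ e $ v) 0) - (\<Sum>v\<in>ed e. max (- \<eta> $ e $ v) 0) = 0" .
    have "(\<Sum>v\<in>ed e. max (\<eta> $ e $ v) 0) + (\<Sum>v\<in>ed e. max (- \<eta> $ e $ v) 0)
        = (\<Sum>v\<in>ed e. \<bar>\<eta> $ e $ v\<bar>)"
      by (simp flip: sum.distrib) (auto intro: sum.cong)
    also have "\<dots> = l1_norm (\<eta> $ e)"
      unfolding l1_norm_def using 0 by (intro sum.mono_neutral_left) auto
    finally have
      "(\<Sum>v\<in>ed e. max (\<eta> $ e $ v) 0) + (\<Sum>v\<in>ed e. max (- \<eta> $ e $ v) 0) = l1_norm (\<eta> $ e)" .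
    with diff show "(\<Sum>v\<in>ed e. max (\<eta> $ e $ v) 0) = l1_norm (\<eta> $ e) / 2"
      "(\<Sum>v\<in>ed e. max (- \<eta> $ e $ v) 0) = l1_norm (\<eta> $ e) / 2"
      by linarith+
  qed
  have "(\<Sum>e | v \<in> ed e. max (\<eta> $ e $ v) 0 - max (- \<eta> $ e $ v) 0) = total_flow \<eta> $ v" for v
  proof -
    have "(\<Sum>e | v \<in> ed e. max (\<eta> $ e $ v) 0 - max (- \<eta> $ e $ v) 0) = (\<Sum>e | v \<in> ed e. \<eta> $ e $ v)"
      by (intro sum.cong) auto
    also have "\<dots> = (\<Sum>e\<in>UNIV. \<eta> $ e $ v)" using 0 by (intro sum.mono_neutral_left) auto
    finally show ?thesis by (simp add: total_flow_nth)
  qed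
  with pos neg show ?thesis
    by (intro edge_massesI[where p = "\<lambda>e v. max (\<eta> $ e $ v) 0" and n = "\<lambda>e v. max (- \<eta> $ e $ v) 0"])
      simp_all
qed

lemma quad_half_l1_norm: "quad w (\<chi> e. l1_norm (\<eta> $ e) / 2) = flow_energy w \<eta>"
  by (simp add: quad_def flow_energy_def sum_distrib_left power_divide)

text \<open>The energy can drop, because \<open>p\<close> and \<open>n\<close> may be positive at
  the same vertex and cancel in the difference.\<close>

lemma flow_of_edge_masses:
  fixes ed :: "'e::finite \<Rightarrow> 'v::finite set"
  assumes "weighted_hypergraph ed w" "\<mu> \<in> edge_masses ed s"
  obtains \<eta> where "\<eta> \<in> flows ed" "total_flow \<eta> = s" "flow_energy w \<eta> \<le> quad w \<mu>"
  using assms(2)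
proof (rule edge_massesE)
  fix p n
  assume pn: "\<And>e v. v \<in> ed e \<Longrightarrow> 0 \<le> p e v" "\<And>e v. v \<in> ed e \<Longrightarrow> 0 \<le> n e v"
    and s: "\<And>v. (\<Sum>e | v \<in> ed e. p e v - n e v) = s $ v"
    and \<mu>: "\<And>e. (\<Sum>v\<in>ed e. p e v) = \<mu> $ e" "\<And>e. (\<Sum>v\<in>ed e. n e v) = \<mu> $ e"
  define \<eta> :: "real ^ 'v ^ 'e" where "\<eta> = (\<chi> e v. if v \<in> ed e then p e v - n e v else 0)"
  have "\<eta> \<in> flows ed"
    by (simp add: flows_iff \<eta>_def \<mu> sum_subtractf flip: sum.inter_filter)
  moreover have "total_flow \<eta> = s"
    by (simp add: vec_eq_iff total_flow_nth \<eta>_def flip: sum.inter_filter s)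
  moreover have "flow_energy w \<eta> \<le> quad w \<mu>"
    \<comment> \<open>Written as \<open>quad\<close> of the half norms, the energy is compared with
      \<open>quad w \<mu>\<close> coordinate by coordinate.\<close>
    unfolding quad_half_l1_norm[symmetric] quad_def
  proof (intro mult_left_mono sum_mono divide_right_mono power_mono)
    fix e
    have "l1_norm (\<eta> $ e) = (\<Sum>v\<in>ed e. \<bar>p e v - n e v\<bar>)"
      by (simp add: l1_norm_def \<eta>_def if_distrib[of abs] flip: sum.inter_filter cong: if_cong)
    also have "\<dots> \<le> (\<Sum>v\<in>ed e. p e v + n e v)"
      using pn by (intro sum_mono) (fastforce simp: abs_le_iff)
    also have "\<dots> = 2 * \<mu> $ e" by (simp add: sum.distrib \<mu>)
    finally show "(\<chi> e. l1_norm (\<eta> $ e) / 2) $ e \<le> \<mu> $ e" by simp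
    show "0 \<le> (\<chi> e. l1_norm (\<eta> $ e) / 2) $ e" by (simp add: l1_norm_def sum_nonneg)
    show "0 \<le> w $ e" using assms(1) by (simp add: weighted_hypergraph_def less_imp_le)
  qed simp
  ultimately show thesis by (rule that)
qed

section \<open>Attainment of the minimal flow energy\<close>

lemma continuous_on_l1_norm [continuous_intros]:
  "continuous_on A f \<Longrightarrow> continuous_on A (\<lambda>x. l1_norm (f x))"
  unfolding l1_norm_def by (intro continuous_intros)

lemma norm_le_l1_norm: "norm x \<le> l1_norm x"
  unfolding l1_norm_def by (rule norm_le_l1_cart)

text \<open>The feasible flows need not be bounded, but the energy controls every edge norm, so the
  sublevel set through \<open>\<eta>\<^sub>0\<close> is compact and nonempty. A minimizer there is
  global, which justifies \<open>LEAST\<close> in \<open>D_star\<close>.\<close>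

lemma D_star_is_min:
  fixes ed :: "'e::finite \<Rightarrow> 'v::finite set"
  assumes w: "weighted_hypergraph ed w" and "\<eta>\<^sub>0 \<in> flows ed" "total_flow \<eta>\<^sub>0 = s"
  shows "is_min (D_star ed w s) (flow_energies ed w s)"
proof -
  have pos: "0 < w $ e" for e using w by (simp add: weighted_hypergraph_def)
  define c where "c = flow_energy w \<eta>\<^sub>0"
  define S where "S = {\<eta> \<in> flows ed. total_flow \<eta> = s \<and> flow_energy w \<eta> \<le> c}"
  have cont: "continuous_on A (flow_energy w)" for A :: "(real ^ 'v ^ 'e) set"
    unfolding flow_energy_def using pos
    by (intro continuous_intros) (auto simp: less_imp_neq[THEN not_sym])
  have "closed {\<eta> :: real ^ 'v ^ 'e. flow_energy w \<eta> \<le> c}"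
    by (intro closed_Collect_le cont continuous_intros)
  moreover have "closed {\<eta>. \<eta> \<in> flows ed}"
    unfolding flows_iff
    by (intro closed_Collect_conj closed_Collect_all closed_Collect_imp closed_Collect_eq
        continuous_intros open_Collect_const)
  moreover have "closed {\<eta> :: real ^ 'v ^ 'e. total_flow \<eta> = s}"
    unfolding total_flow_def by (intro closed_Collect_eq continuous_intros)
  ultimately have "closed S" unfolding S_def by (intro closed_Collect_conj)
  have "norm \<eta> \<le> (\<Sum>e\<in>UNIV. sqrt (8 * w $ e * c))" if "\<eta> \<in> S" for \<eta>
  proof -
    have "l1_norm (\<eta> $ e) \<le> sqrt (8 * w $ e * c)" for e
    proof (rule real_le_rsqrt)
      \<comment> \<open>All summands of the energy are nonnegative, so each one alone is at most the
        level \<open>c\<close>.\<close>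
      have "(l1_norm (\<eta> $ e))\<^sup>2 / (8 * w $ e) \<le> flow_energy w \<eta>"
        unfolding flow_energy_def using pos
        by (intro member_le_sum) (auto simp: less_imp_le)
      also have "\<dots> \<le> c" using that by (simp add: S_def)
      finally show "(l1_norm (\<eta> $ e))\<^sup>2 \<le> 8 * w $ e * c"
        using pos[of e] by (simp add: field_simps)
    qed
    then have "norm (\<eta> $ e) \<le> sqrt (8 * w $ e * c)" for e
      using norm_le_l1_norm order_trans by blast
    then have "(\<Sum>e\<in>UNIV. norm (\<eta> $ e)) \<le> (\<Sum>e\<in>UNIV. sqrt (8 * w $ e * c))"
      by (intro sum_mono)
    moreover have "norm \<eta> \<le> (\<Sum>e\<in>UNIV. norm (\<eta> $ e))"
      unfolding norm_vec_def by (intro L2_set_le_sum) auto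
    ultimately show ?thesis by linarith
  qed
  then have "bounded S" by (rule boundedI)
  with \<open>closed S\<close> have "compact S" by (simp add: compact_eq_bounded_closed)
  moreover have "\<eta>\<^sub>0 \<in> S" using assms by (simp add: S_def c_def)
  ultimately obtain \<eta> where \<eta>: "\<eta> \<in> S" "\<forall>\<theta>\<in>S. flow_energy w \<eta> \<le> flow_energy w \<theta>"
    using continuous_attains_inf[OF _ _ cont] by (metis empty_iff)
  have min: "is_min (flow_energy w \<eta>) (flow_energies ed w s)"
    unfolding is_min_def
  proof
    show "flow_energy w \<eta> \<in> flow_energies ed w s"
      using \<eta>(1) by (auto simp: S_def flow_energies_def)
    show "\<forall>y\<in>flow_energies ed w s. flow_energy w \<eta> \<le> y"
    proof
      fix y assume "y \<in> flow_energies ed w s"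
      then obtain \<theta> where \<theta>: "\<theta> \<in> flows ed" "total_flow \<theta> = s" "y = flow_energy w \<theta>"
        by (auto simp: flow_energies_def)
      show "flow_energy w \<eta> \<le> y"
      \<comment> \<open>Feasible flows outside \<open>S\<close> have energy above \<open>c\<close>,
        hence above that of the minimizer.\<close>
      proof (cases "y \<le> c")
        case True
        with \<theta> \<eta>(2) show ?thesis by (auto simp: S_def)
      next
        case False
        with \<eta>(1) show ?thesis by (simp add: S_def)
      qed
    qed
  qed
  then have "D_star ed w s = flow_energy w \<eta>"
    unfolding D_star_def is_min_def by (intro Least_equality) auto
  with min show ?thesis by simp
qed

text \<open>Every flow has a mass vector of equal cost, and every mass vector has a flow of no
  larger cost, so an attained minimum carries over.\<close>

lemma quad_is_min:
  fixes ed :: "'e::finite \<Rightarrow> 'v::finite set"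
  assumes w: "weighted_hypergraph ed w" and min: "is_min m (flow_energies ed w s)"
  shows "is_min m (quad w ` edge_masses ed s)"
  unfolding is_min_def
proof
  obtain \<eta> where \<eta>: "\<eta> \<in> flows ed" "total_flow \<eta> = s" "m = flow_energy w \<eta>"
    using min by (auto simp: is_min_def flow_energies_def)
  show "m \<in> quad w ` edge_masses ed s"
    using edge_masses_of_flow[OF \<eta>(1)] \<eta>(2,3) quad_half_l1_norm[of w \<eta>] by (metis image_eqI)
  show "\<forall>y\<in>quad w ` edge_masses ed s. m \<le> y"
  proof clarify
    fix \<mu> assume "\<mu> \<in> edge_masses ed s"
    from flow_of_edge_masses[OF w this] obtain \<theta>
      where "\<theta> \<in> flows ed" "total_flow \<theta> = s" "flow_energy w \<theta> \<le> quad w \<mu>" .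
    moreover from this have "m \<le> flow_energy w \<theta>"
      using min by (auto simp: is_min_def flow_energies_def)
    ultimately show "m \<le> quad w \<mu>" by linarith
  qed
qed

section \<open>The lifted graph\<close>

lemma lift_incidence_Vert:
  "lift_incidence ed f $ Vert v = (\<Sum>e | v \<in> ed e. f (Plus e, Vert v) - f (Vert v, Minus e))"
proof -
  have "{a. a \<in> lift_arcs ed \<and> snd a = Vert v} = (\<lambda>e. (Plus e, Vert v)) ` {e. v \<in> ed e}"
    "{a. a \<in> lift_arcs ed \<and> fst a = Vert v} = (\<lambda>e. (Vert v, Minus e)) ` {e. v \<in> ed e}"
    by (auto simp: lift_arcs_def)
  then show ?thesis by (simp add: lift_incidence_def sum.reindex inj_on_def sum_subtractf)
qed

lemma lift_incidence_Plus:
  "lift_incidence ed f $ Plus e = f (Minus e, Plus e) - (\<Sum>v\<in>ed e. f (Plus e, Vert v))"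
proof -
  have "{a. a \<in> lift_arcs ed \<and> snd a = Plus e} = {(Minus e, Plus e)}"
    "{a. a \<in> lift_arcs ed \<and> fst a = Plus e} = (\<lambda>v. (Plus e, Vert v)) ` ed e"
    by (auto simp: lift_arcs_def)
  then show ?thesis by (simp add: lift_incidence_def sum.reindex inj_on_def)
qed

lemma lift_incidence_Minus:
  "lift_incidence ed f $ Minus e = (\<Sum>v\<in>ed e. f (Vert v, Minus e)) - f (Minus e, Plus e)"
proof -
  have "{a. a \<in> lift_arcs ed \<and> snd a = Minus e} = (\<lambda>v. (Vert v, Minus e)) ` ed e"
    "{a. a \<in> lift_arcs ed \<and> fst a = Minus e} = {(Minus e, Plus e)}"
    by (auto simp: lift_arcs_def)
  then show ?thesis by (simp add: lift_incidence_def sum.reindex inj_on_def)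
qed

lemma all_lnode: "(\<forall>u. P u) \<longleftrightarrow> (\<forall>v. P (Vert v)) \<and> (\<forall>e. P (Plus e)) \<and> (\<forall>e. P (Minus e))"
  by (metis lnode.exhaust)

text \<open>Conservation at the three kinds of nodes is the definition of
  \<open>edge_masses\<close>, with \<open>p\<close> and \<open>n\<close> on the outer arcs and the
  mass on the middle arc.\<close>

lemma lift_flows_iff:
  fixes ed :: "'e::finite \<Rightarrow> 'v::finite set"
  shows "f \<in> lift_flows ed s \<longleftrightarrow>
    (\<forall>v. (\<Sum>e | v \<in> ed e. f (Plus e, Vert v) - f (Vert v, Minus e)) = s $ v) \<and>
    (\<forall>e. (\<Sum>v\<in>ed e. f (Plus e, Vert v)) = f (Minus e, Plus e)) \<and>
    (\<forall>e. (\<Sum>v\<in>ed e. f (Vert v, Minus e)) = f (Minus e, Plus e)) \<and>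
    (\<forall>a\<in>lift_arcs ed. 0 \<le> f a)"
  by (auto simp: lift_flows_def vec_eq_iff all_lnode lift_demand_def lift_incidence_Vert
      lift_incidence_Plus lift_incidence_Minus)

lemma lift_cost_sum:
  fixes ed :: "'e::finite \<Rightarrow> 'v::finite set"
  shows "(\<Sum>a\<in>lift_arcs ed. lift_cost r a * f a) = (\<Sum>e\<in>UNIV. r $ e * f (Minus e, Plus e))"
proof -
  let ?I = "range (\<lambda>e. (Minus e, Plus e)) :: ('v, 'e) larc set"
  have "(\<Sum>a\<in>lift_arcs ed. lift_cost r a * f a) = (\<Sum>a\<in>?I. lift_cost r a * f a)"
    by (intro sum.mono_neutral_right) (auto simp: lift_arcs_def lift_cost_def)
  then show ?thesis by (simp add: sum.reindex inj_on_def lift_cost_def)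
qed

text \<open>The two problems have the same set of values, so attained minima transfer by
  rewriting.\<close>

lemma lift_cost_image:
  fixes ed :: "'e::finite \<Rightarrow> 'v::finite set"
  shows "(\<lambda>f. \<Sum>a\<in>lift_arcs ed. lift_cost r a * f a) ` lift_flows ed s =
    (\<lambda>\<mu>. \<Sum>e\<in>UNIV. r $ e * \<mu> $ e) ` edge_masses ed s" (is "?F ` _ = ?M ` _")
proof
  show "?F ` lift_flows ed s \<subseteq> ?M ` edge_masses ed s"
  proof (rule image_subsetI)
    fix f assume "f \<in> lift_flows ed s"
    then have "(\<chi> e. f (Minus e, Plus e)) \<in> edge_masses ed s"
      by (intro edge_massesI[where p = "\<lambda>e v. f (Plus e, Vert v)" and n = "\<lambda>e v. f (Vert v, Minus e)"])
        (auto simp: lift_flows_iff lift_arcs_def)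
    then show "?F f \<in> ?M ` edge_masses ed s"
      by (rule rev_image_eqI) (simp add: lift_cost_sum)
  qed
  show "?M ` edge_masses ed s \<subseteq> ?F ` lift_flows ed s"
  proof (rule image_subsetI)
    fix \<mu> assume \<mu>: "\<mu> \<in> edge_masses ed s"
    then show "?M \<mu> \<in> ?F ` lift_flows ed s"
    proof (rule edge_massesE)
      fix p n
      assume pn: "\<And>e v. v \<in> ed e \<Longrightarrow> 0 \<le> p e v" "\<And>e v. v \<in> ed e \<Longrightarrow> 0 \<le> n e v"
        "\<And>v. (\<Sum>e | v \<in> ed e. p e v - n e v) = s $ v"
        "\<And>e. (\<Sum>v\<in>ed e. p e v) = \<mu> $ e" "\<And>e. (\<Sum>v\<in>ed e. n e v) = \<mu> $ e"
      \<comment> \<open>The wildcard is harmless: the only arc leaving \<open>Minus e\<close> goes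
        to \<open>Plus e\<close>. The default 0 is taken off the arc set only.\<close>
      define f :: "('v, 'e) larc \<Rightarrow> real" where "f a = (case a of (Plus e, Vert v) \<Rightarrow> p e v
        | (Vert v, Minus e) \<Rightarrow> n e v | (Minus e, _) \<Rightarrow> \<mu> $ e | _ \<Rightarrow> 0)" for a
      have "f \<in> lift_flows ed s"
        using pn edge_masses_nonneg[OF \<mu>] by (auto simp: lift_flows_iff f_def lift_arcs_def)
      then show ?thesis by (rule rev_image_eqI) (simp add: lift_cost_sum f_def)
    qed
  qed
qed

lemma lift_demand_inner: "lift_demand s \<bullet> \<pi> = s \<bullet> (\<chi> v. \<pi> $ Vert v)"
proof -
  have "lift_demand s \<bullet> \<pi> = (\<Sum>u\<in>range Vert. lift_demand s $ u * \<pi> $ u)"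
    unfolding inner_vec_def inner_real_def
    by (intro sum.mono_neutral_right) (auto simp: lift_demand_def split: lnode.split)
  then show ?thesis by (simp add: inner_vec_def sum.reindex inj_on_def lift_demand_def)
qed

lemma optimal_potential_recenter:
  fixes ed :: "'e::finite \<Rightarrow> 'v::finite set"
  assumes w: "weighted_hypergraph ed w" and "1 \<bullet> s = 0"
    and max: "is_max (support_value ed w s r) ((\<lambda>x. s \<bullet> x) ` support_feasible ed w r)"
    and \<pi>: "optimal_potential ed w s r \<pi>"
  shows "is_arg_max (\<lambda>x. s \<bullet> x) (\<lambda>x. x \<in> support_feasible ed w r)
    (recenter ed w (\<chi> v. \<pi> $ Vert v))"
proof -
  let ?x = "\<chi> v. \<pi> $ Vert v"
  have arc: "\<pi> $ snd a - \<pi> $ fst a \<le> lift_cost r a" if "a \<in> lift_arcs ed" for a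
    using \<pi> that by (simp add: optimal_potential_def lift_coboundary_def)
  \<comment> \<open>The dual constraints telescope along the path from \<open>Vert v\<close> through
    \<open>Minus e\<close> and \<open>Plus e\<close> to \<open>Vert u\<close>, whose arcs cost 0,
    \<open>r $ e\<close> and 0.\<close>
  have "?x $ u - ?x $ v \<le> r $ e" if "u \<in> ed e" "v \<in> ed e" for e u v
    using arc[of "(Plus e, Vert u)"] arc[of "(Vert v, Minus e)"] arc[of "(Minus e, Plus e)"] that
    by (simp add: lift_arcs_def lift_cost_def)
  then have "recenter ed w ?x \<in> support_feasible ed w r"
    by (rule recenter_support_feasible[OF w])
  moreover have "s \<bullet> recenter ed w ?x = support_value ed w s r"
    using \<pi> by (simp add: inner_recenter assms(2) optimal_potential_def lift_demand_inner)
  ultimately show ?thesis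
    using max by (auto simp: is_arg_max_def is_max_def not_less)
qed

section \<open>Combination of duality, energy minimum and lifted graph\<close>

theorem theorem4p1:
  fixes ed :: "'e::finite \<Rightarrow> 'v::finite set"
    and w :: "real ^ 'e"
    and s :: "real ^ 'v"
  assumes "weighted_hypergraph ed w"
    and "hyper_connected ed"
    and "1 \<bullet> s = 0"
  shows "is_min (D_star ed w s) (flow_energies ed w s) \<and>
    is_min (D_star ed w s) (quad w ` edge_masses ed s) \<and>
    (\<forall>r :: real ^ 'e. (\<forall>e. 0 \<le> r $ e) \<longrightarrow>
      is_max (support_value ed w s r) ((\<lambda>x. s \<bullet> x) ` support_feasible ed w r) \<and>
      is_min (support_value ed w s r) ((\<lambda>\<mu>. \<Sum>e\<in>UNIV. r $ e * \<mu> $ e) ` edge_masses ed s) \<and>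
      is_min (support_value ed w s r)
        ((\<lambda>f. \<Sum>a\<in>lift_arcs ed. lift_cost r a * f a) ` lift_flows ed s) \<and>
      (\<forall>\<pi> :: real ^ ('v, 'e) lnode. optimal_potential ed w s r \<pi> \<longrightarrow>
        is_arg_max (\<lambda>x. s \<bullet> x) (\<lambda>x. x \<in> support_feasible ed w r)
          (\<chi> v. \<pi> $ Vert v -
             (\<Sum>u\<in>UNIV. deg ed w u * \<pi> $ Vert u) / (\<Sum>u\<in>UNIV. deg ed w u))))"
proof (intro conjI allI impI)
  let ?mass = "\<lambda>r :: real ^ 'e. (\<lambda>\<mu>. \<Sum>e\<in>UNIV. r $ e * \<mu> $ e) ` edge_masses ed s"
  have max: "is_max (support_value ed w s r) ((\<lambda>x. s \<bullet> x) ` support_feasible ed w r)"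
    if "\<forall>e. 0 \<le> r $ e" for r
    using support_value_is_max[OF assms(1,2) that] .
  have min: "is_min (support_value ed w s r) (?mass r)" if r: "\<forall>e. 0 \<le> r $ e" for r
  proof -
    obtain x where x: "x \<in> support_feasible ed w r" "support_value ed w s r = s \<bullet> x"
      using max[OF r] by (auto simp: is_max_def)
    have weak: "support_value ed w s r \<le> (\<Sum>e\<in>UNIV. r $ e * \<mu> $ e)" if "\<mu> \<in> edge_masses ed s" for \<mu>
      using edge_masses_weak_duality[OF that] x by (simp add: support_feasible_def)
    obtain \<mu> where \<mu>: "\<mu> \<in> edge_masses ed s"
      "(\<Sum>e\<in>UNIV. r $ e * \<mu> $ e) \<le> support_value ed w s r"
      using edge_masses_strong_duality[OF assms, of r "support_value ed w s r"] max[OF r]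
      by (auto simp: is_max_def)
    with weak have "support_value ed w s r = (\<Sum>e\<in>UNIV. r $ e * \<mu> $ e)"
      by (simp add: order_antisym)
    with weak \<mu>(1) show ?thesis by (auto simp: is_min_def)
  qed
  \<comment> \<open>Duality at \<open>r = 0\<close> supplies a feasible mass vector, and from it the
    feasible flow that starts the energy minimization.\<close>
  obtain \<mu> where "\<mu> \<in> edge_masses ed s" using min[of 0] by (auto simp: is_min_def)
  then obtain \<eta> where "\<eta> \<in> flows ed" "total_flow \<eta> = s"
    by (rule flow_of_edge_masses[OF assms(1)])
  then show D: "is_min (D_star ed w s) (flow_energies ed w s)"
    by (rule D_star_is_min[OF assms(1)])
  show "is_min (D_star ed w s) (quad w ` edge_masses ed s)"
    by (rule quad_is_min[OF assms(1) D])
  fix r :: "real ^ 'e" assume r: "\<forall>e. 0 \<le> r $ e"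
  show "is_max (support_value ed w s r) ((\<lambda>x. s \<bullet> x) ` support_feasible ed w r)"
    by (rule max[OF r])
  show "is_min (support_value ed w s r) (?mass r)" by (rule min[OF r])
  then show "is_min (support_value ed w s r)
      ((\<lambda>f. \<Sum>a\<in>lift_arcs ed. lift_cost r a * f a) ` lift_flows ed s)"
    by (simp only: lift_cost_image)
  fix \<pi> :: "real ^ ('v, 'e) lnode" assume "optimal_potential ed w s r \<pi>"
  from optimal_potential_recenter[OF assms(1,3) max[OF r] this]
  show "is_arg_max (\<lambda>x. s \<bullet> x) (\<lambda>x. x \<in> support_feasible ed w r)
      (\<chi> v. \<pi> $ Vert v - (\<Sum>u\<in>UNIV. deg ed w u * \<pi> $ Vert u) / (\<Sum>u\<in>UNIV. deg ed w u))"
    by (simp add: recenter_def)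
qed

end
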